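(* For every integer $k \ge 2$ and every real $\alpha > 0$, there exists $\delta = \delta(\alpha,k) > 0$ such that the following holds. Let $n \in \mathbb{N}$ and let $\mathcal{F} \subset \mathcal{P}(n)$ satisfy $|\mathcal{F}| \ge (k-1+\alpha)\binom{n}{\lfloor n/2\rfloor}$, and suppose that the real number $m$ satisfies $m \ge \delta^{-1}$ and $m \le \binom{|F|}{|G|}$ for every $F, G \in \mathcal{F}$ with $F \supsetneq G$. Then there exists $\mathcal{H} \subset \mathcal{G}_k[\mathcal{F}]$ satisfying (a) $e(\mathcal{H}) \ge \delta^k m^{k-1} \binom{n}{\lfloor n/2\rfloor}$, and (b) $\Delta_\ell(\mathcal{H}) \le (\delta m)^{k-\ell}$ for every $1 \le \ell \le k$.
   Context: $\mathcal{P}(n)$ is the family of all subsets of $\{1,\dots,n\}$. $\mathcal{G}_k = \mathcal{G}_k(n)$ is the $k$-uniform hypergraph with vertex set $\mathcal{P}(n)$ whose edges are the sets $\{F_1,\dots,F_k\}$ such that $F_1 \supsetneq \cdots \supsetneq F_k$ for some ordering of the elements ($k$-chains). For $\mathcal{F} \subset \mathcal{P}(n)$, the notation $\mathcal{H} \subset \mathcal{G}_k[\mathcal{F}]$ means that $\mathcal{H}$ is a $k$-uniform hypergraph with vertex set $\mathcal{F}$ all of whose edges are edges of $\mathcal{G}_k$. $e(\mathcal{H})$ is the number of edges of $\mathcal{H}$. For a set $\mathcal{A}$ of vertices, $d_{\mathcal{H}}(\mathcal{A}) = |\{\mathcal{B} \in E(\mathcal{H}) : \mathcal{A} \subset \mathcal{B}\}|$,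 and $\Delta_\ell(\mathcal{H}) = \max\{ d_{\mathcal{H}}(\mathcal{A}) : \mathcal{A} \subset V(\mathcal{H}),\ |\mathcal{A}| = \ell\}$. *)

theory Defs
  imports Complex_Main
begin

record 'v hypergraph =
  verts :: "'v set"
  edges :: "'v set set"

definition uniform_hypergraph :: "nat \<Rightarrow> 'v hypergraph \<Rightarrow> bool" where
  "uniform_hypergraph k H \<longleftrightarrow> (\<forall>B\<in>edges H. B \<subseteq> verts H \<and> finite B \<and> card B = k)"

definition num_edges :: "'v hypergraph \<Rightarrow> nat" where
  "num_edges H = card (edges H)"

definition hdegree :: "'v hypergraph \<Rightarrow> 'v set \<Rightarrow> nat" where
  "hdegree H A = card {B \<in> edges H. A \<subseteq> B}"

(* Meaningful when verts H is finite with at least l elements, so that Max is taken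
   over a finite nonempty set. *)
definition max_degree :: "nat \<Rightarrow> 'v hypergraph \<Rightarrow> nat" where
  "max_degree l H = Max {hdegree H A | A. A \<subseteq> verts H \<and> finite A \<and> card A = l}"

definition chain_hypergraph :: "nat \<Rightarrow> nat \<Rightarrow> nat set hypergraph" where
  "chain_hypergraph k n =
     \<lparr>verts = Pow {1..n},
      edges = {set Fs | Fs. set Fs \<subseteq> Pow {1..n} \<and> length Fs = k \<and> sorted_wrt (\<supset>) Fs}\<rparr>"

(* The relation written "H \<subset> G[F]" in the literature: the vertex set of H is
   all of F, and the edges of H form an arbitrary subset of the edges of G lying in F. *)
definition subhypergraph_on :: "nat \<Rightarrow> 'v hypergraph \<Rightarrow> 'v hypergraph \<Rightarrow> 'v set \<Rightarrow> bool" where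
  "subhypergraph_on k H G F \<longleftrightarrow>
     uniform_hypergraph k H \<and> verts H = F \<and> edges H \<subseteq> edges G"

end

theory Submission
  imports Defs "HOL-Combinatorics.Multiset_Permutations"
begin

text \<open>
  Take a uniformly random maximal chain of \<open>\<P>(n)\<close> together with an independent uniform
  \<open>u \<in> {1..N}\<close>, where \<open>N\<close> is the middle binomial coefficient, and keep only those members \<open>X\<close>
  of the chain with \<open>u \<le> binom(n, |X|)\<close>. Every set is then kept with probability exactly \<open>1/N\<close>,
  whatever its size, and a chain \<open>A\<close> in \<open>\<F>\<close> with probability at most
  \<open>1 / (m^(|A| - 1) N)\<close>. Put \<open>q = \<delta> m\<close> and let \<open>E\<close> be a maximal family of \<open>k\<close>-chains in \<open>\<F>\<close>
  in which every \<open>\<ell>\<close>-set has degree at most \<open>q^(k - \<ell>)\<close>. By maximality every \<open>k\<close>-chain in \<open>\<F>\<close>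
  contains a saturated set, so deleting one point from each saturated set of a kept chain leaves
  at most \<open>k - 1\<close> members of \<open>\<F>\<close>. In expectation, \<open>|\<F>|/N\<close> is thus at most \<open>k - 1\<close> plus the
  expected number of saturated sets in the kept chain, and the latter is at most
  \<open>2^(k + 1) |E| / (q^(k - 1) N)\<close> since the degrees of saturated sets are large.
\<close>

section \<open>Random truncated maximal chains\<close>

text \<open>A maximal chain of subsets of \<open>S\<close> is encoded as a permutation of
  \<open>S\<close>, its members being the sets of entries of the prefixes. Hence \<open>X\<close> is
  on the chain iff the prefix of length \<open>card X\<close> has exactly the entries of
  \<open>X\<close>.\<close>

definition flags_through :: "'a set \<Rightarrow> 'a set set \<Rightarrow> 'a list set" where
  "flags_through S A = {xs \<in> permutations_of_set S. \<forall>X\<in>A. set (take (card X) xs) = X}"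

text \<open>The event that all of \<open>A\<close> is kept; \<open>A = {}\<close> gives the whole
  sample space, so probabilities can be handled as cardinalities.\<close>

definition truncated_flags_through :: "'a set \<Rightarrow> 'a set set \<Rightarrow> ('a list \<times> nat) set" where
  "truncated_flags_through S A = {(xs, u). xs \<in> flags_through S A \<and>
     u \<in> {1..card S choose (card S div 2)} \<and> (\<forall>X\<in>A. u \<le> card S choose card X)}"

lemma finite_flags_through [simp]: "finite S \<Longrightarrow> finite (flags_through S A)"
  unfolding flags_through_def by auto

text \<open>Cut the permutation at position \<open>card X\<close>: the prefix is a flag of
  \<open>X\<close> through \<open>A\<close>, the rest an arbitrary ordering of \<open>S - X\<close>.
  Since \<open>A\<close> lies below \<open>X\<close>, its conditions concern the prefix
  alone.\<close>

lemma card_flags_through_insert: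
  assumes "finite S" "X \<subseteq> S" "\<And>Y. Y \<in> A \<Longrightarrow> Y \<subseteq> X"
  shows "card (flags_through S (insert X A)) = card (flags_through X A) * fact (card S - card X)"
proof -
  have fX: "finite X" using assms finite_subset by blast
  have le: "card Y \<le> card X" if "Y \<in> A" for Y
    using assms(3)[OF that] fX card_mono by blast
  have "bij_betw (\<lambda>(ys, zs). ys @ zs) (flags_through X A \<times> permutations_of_set (S - X))
          (flags_through S (insert X A))"
  proof (rule bij_betw_imageI)
    show "inj_on (\<lambda>(ys, zs). ys @ zs) (flags_through X A \<times> permutations_of_set (S - X))"
      by (auto simp: inj_on_def flags_through_def dest!: length_finite_permutations_of_set)
    show "(\<lambda>(ys, zs). ys @ zs) ` (flags_through X A \<times> permutations_of_set (S - X))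
            = flags_through S (insert X A)"
    proof (intro set_eqI iffI)
      fix xs assume "xs \<in> (\<lambda>(ys, zs). ys @ zs) ` (flags_through X A \<times> permutations_of_set (S - X))"
      then obtain ys zs where xs: "xs = ys @ zs" and ys: "ys \<in> flags_through X A"
        and zs: "zs \<in> permutations_of_set (S - X)" by auto
      have l: "length ys = card X"
        using ys by (auto simp: flags_through_def length_finite_permutations_of_set)
      show "xs \<in> flags_through S (insert X A)"
        using ys zs l le assms(2) unfolding xs flags_through_def
        by (auto simp: permutations_of_set_def)
    next
      fix xs assume "xs \<in> flags_through S (insert X A)"
      then have xs: "set xs = S" "distinct xs" and X: "set (take (card X) xs) = X"
        and A: "\<And>Y. Y \<in> A \<Longrightarrow> set (take (card Y) xs) = Y"
        by (auto simp: flags_through_def permutations_of_set_def)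
      have "set (drop (card X) xs) = S - X"
        using xs X by (metis Diff_cancel Un_Diff Diff_triv append_take_drop_id distinct_append
            inf_commute set_append sup_bot_left)
      then have "drop (card X) xs \<in> permutations_of_set (S - X)"
        using xs by (auto simp: permutations_of_set_def)
      moreover have "take (card X) xs \<in> flags_through X A"
        using xs X A le by (auto simp: flags_through_def permutations_of_set_def min_def)
      ultimately show "xs \<in> (\<lambda>(ys, zs). ys @ zs) ` (flags_through X A \<times> permutations_of_set (S - X))"
        by (intro image_eqI[of _ _ "(take (card X) xs, drop (card X) xs)"]) auto
    qed
  qed
  from bij_betw_same_card[OF this] show ?thesis
    using assms fX by (simp add: card_cartesian_product card_Diff_subset)
qed

text \<open>Induction from the top of the chain, with \<open>X\<close> taking over as ambient set:
  each further step down from \<open>X\<close> to \<open>Y\<close> costs a factor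
  \<open>card X choose card Y\<close>, which is at least \<open>q\<close>. The factor
  \<open>card S choose card X\<close> of the top set is kept apart because nothing bounds it below;
  the cutoff \<open>u\<close> absorbs it later.\<close>

lemma card_flags_through_chain_le:
  fixes q :: real
  assumes "finite S" "X \<subseteq> S" "sorted_wrt (\<supset>) (X # Xs)" "q \<ge> 0"
    and "\<And>F G. F \<in> set (X # Xs) \<Longrightarrow> G \<in> set (X # Xs) \<Longrightarrow> F \<supset> G \<Longrightarrow> q \<le> real (card F choose card G)"
  shows "real (card (flags_through S (set (X # Xs)))) * real (card S choose card X) * q ^ length Xs
           \<le> fact (card S)"
  using assms
proof (induction Xs arbitrary: S X)
  case Nil
  have "card (flags_through X {}) = fact (card X)"
    using Nil finite_subset[of X S] by (simp add: flags_through_def)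
  moreover have "card X \<le> card S" using Nil card_mono by blast
  ultimately have "card (flags_through S {X}) * (card S choose card X) = fact (card S)"
    using card_flags_through_insert[of S X "{}"] Nil binomial_fact_lemma[of "card X" "card S"]
    by simp
  then show ?case by (simp flip: of_nat_mult)
next
  case (Cons Y Ys)
  have fX: "finite X" using finite_subset[OF Cons.prems(2,1)] .
  have le: "card X \<le> card S" using card_mono[OF Cons.prems(1,2)] .
  have sub: "Z \<subset> X" if "Z \<in> set (Y # Ys)" for Z using Cons.prems(3) that by auto
  have count: "card (flags_through S (set (X # Y # Ys)))
      = card (flags_through X (set (Y # Ys))) * fact (card S - card X)"
    using card_flags_through_insert[OF Cons.prems(1,2), of "set (Y # Ys)"] sub by auto
  have IH: "real (card (flags_through X (set (Y # Ys)))) * real (card X choose card Y) * q ^ length Ys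
      \<le> fact (card X)"
  proof (rule Cons.IH[OF fX])
    show "Y \<subseteq> X" using sub by auto
    show "sorted_wrt (\<supset>) (Y # Ys)" using Cons.prems(3) by simp
    show "q \<le> real (card F choose card G)"
      if "F \<in> set (Y # Ys)" "G \<in> set (Y # Ys)" "F \<supset> G" for F G
      using that by (intro Cons.prems(5)) auto
  qed (rule Cons.prems(4))
  have q: "q \<le> real (card X choose card Y)"
    using sub by (intro Cons.prems(5)) auto
  let ?c = "real (card (flags_through X (set (Y # Ys))))"
  let ?d = "fact (card S - card X) * real (card S choose card X)"
  have "real (card (flags_through S (set (X # Y # Ys)))) * real (card S choose card X) * q ^ length (Y # Ys)
      = ?d * (?c * q * q ^ length Ys)"
    unfolding count by simp
  also have "\<dots> \<le> ?d * (?c * real (card X choose card Y) * q ^ length Ys)"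
    using q \<open>q \<ge> 0\<close> by (intro mult_left_mono mult_right_mono) auto
  also have "\<dots> \<le> ?d * fact (card X)"
    using IH by (intro mult_left_mono) auto
  also have "\<dots> = real (fact (card X) * fact (card S - card X) * (card S choose card X))"
    by simp
  also have "\<dots> = fact (card S)"
    by (simp only: binomial_fact_lemma[OF le] of_nat_fact)
  finally show ?case .
qed

lemma finite_truncated_flags_through [simp]:
  assumes "finite S" shows "finite (truncated_flags_through S A)"
proof (rule finite_subset)
  show "truncated_flags_through S A
      \<subseteq> flags_through S A \<times> {1..card S choose (card S div 2)}"
    by (auto simp: truncated_flags_through_def)
qed (use assms in auto)

lemma card_truncated_flags_through_empty:
  "finite S \<Longrightarrow> card (truncated_flags_through S {}) = fact (card S) * (card S choose (card S div 2))"
proof -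
  assume "finite S"
  moreover have "truncated_flags_through S {}
      = permutations_of_set S \<times> {1..card S choose (card S div 2)}"
    by (auto simp: truncated_flags_through_def flags_through_def)
  ultimately show ?thesis by (simp add: card_cartesian_product)
qed

text \<open>The number of admissible cutoffs cancels the binomial coefficient in the number of flags
  through \<open>X\<close>, so the count is the same for every size of \<open>X\<close>.\<close>

lemma card_truncated_flags_through_singleton:
  assumes "finite S" "X \<subseteq> S"
  shows "card (truncated_flags_through S {X}) = fact (card S)"
proof -
  have "truncated_flags_through S {X} = flags_through S {X} \<times> {1..card S choose card X}"
    \<comment> \<open>The middle coefficient is the largest, so all cutoffs up to
      \<open>card S choose card X\<close> lie in the sample range.\<close>
    using binomial_maximum[of "card S" "card X"]
    by (auto simp: truncated_flags_through_def intro: order.trans)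
  moreover have "card (flags_through X {}) = fact (card X)"
    using assms finite_subset[of X S] by (simp add: flags_through_def)
  moreover have "card X \<le> card S" using assms card_mono by blast
  ultimately show ?thesis
    using card_flags_through_insert[of S X "{}"] assms binomial_fact_lemma[of "card X" "card S"]
    by (simp add: card_cartesian_product)
qed

text \<open>The top set alone restricts \<open>u\<close> to at most
  \<open>card S choose card X\<close> values, which pays for the extra factor in the bound on
  flags.\<close>

lemma card_truncated_flags_through_chain_le:
  fixes q :: real
  assumes "finite S" "set Xs \<subseteq> Pow S" "sorted_wrt (\<supset>) Xs" "Xs \<noteq> []" "q \<ge> 0"
    and "\<And>F G. F \<in> set Xs \<Longrightarrow> G \<in> set Xs \<Longrightarrow> F \<supset> G \<Longrightarrow> q \<le> real (card F choose card G)"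
  shows "real (card (truncated_flags_through S (set Xs))) * q ^ (length Xs - 1) \<le> fact (card S)"
proof -
  obtain X Ys where Xs: "Xs = X # Ys" using assms(4) by (cases Xs) auto
  have "truncated_flags_through S (set Xs) \<subseteq> flags_through S (set Xs) \<times> {1..card S choose card X}"
    unfolding Xs truncated_flags_through_def by auto
  then have "card (truncated_flags_through S (set Xs))
      \<le> card (flags_through S (set Xs) \<times> {1..card S choose card X})"
    using assms(1) by (intro card_mono) auto
  then have "real (card (truncated_flags_through S (set Xs)))
      \<le> real (card (flags_through S (set Xs))) * real (card S choose card X)"
    by (simp add: card_cartesian_product flip: of_nat_mult)
  then have "real (card (truncated_flags_through S (set Xs))) * q ^ (length Xs - 1)
      \<le> real (card (flags_through S (set Xs))) * real (card S choose card X) * q ^ length Ys"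
    unfolding Xs using assms(5) by (simp add: mult_right_mono)
  also have "\<dots> \<le> fact (card S)"
    using card_flags_through_chain_le[of S X Ys q] assms unfolding Xs by auto
  finally show ?thesis .
qed

section \<open>Maximal families of bounded degree\<close>

text \<open>\<open>E\<close> is inclusion-maximal among the families obeying the degree bounds.
  Adding a missing \<open>B\<close> can only violate the bound at some nonempty \<open>A\<close>
  inside \<open>B\<close>, so such an \<open>A\<close> is saturated: one more edge would exceed its
  bound.\<close>

lemma maximal_bounded_degree_family:
  fixes q :: real and K :: "'a set set"
  assumes "finite K" "\<And>B. B \<in> K \<Longrightarrow> card B = k" "k \<ge> 1" "q \<ge> 1"
  obtains E where "E \<subseteq> K"
    and "\<And>A. card A \<in> {1..k} \<Longrightarrow> real (card {B \<in> E. A \<subseteq> B}) \<le> q ^ (k - card A)"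
    and "\<And>B. B \<in> K \<Longrightarrow> \<exists>A\<subseteq>B. A \<noteq> {} \<and> q ^ (k - card A) < real (card {C \<in> E. A \<subseteq> C}) + 1"
proof -
  define good where "good = {E. E \<subseteq> K \<and>
      (\<forall>A. card A \<in> {1..k} \<longrightarrow> real (card {B \<in> E. A \<subseteq> B}) \<le> q ^ (k - card A))}"
  have "finite good" using assms(1) by (auto simp: good_def)
  moreover have "{} \<in> good" using assms(4) by (auto simp: good_def)
  ultimately obtain E where E: "E \<in> good" and max: "\<And>E'. E' \<in> good \<Longrightarrow> E \<subseteq> E' \<Longrightarrow> E' = E"
    using finite_has_maximal[of good] by blast
  have fE: "finite E" using E assms(1) finite_subset by (auto simp: good_def)
  show ?thesis
  proof (rule that[of E])
    show "E \<subseteq> K" using E by (auto simp: good_def)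
    show "real (card {B \<in> E. A \<subseteq> B}) \<le> q ^ (k - card A)" if "card A \<in> {1..k}" for A
      using E that by (auto simp: good_def)
    fix B assume B: "B \<in> K"
    have fB: "finite B" using assms(2)[OF B] assms(3) by (metis card.infinite not_one_le_zero)
    show "\<exists>A\<subseteq>B. A \<noteq> {} \<and> q ^ (k - card A) < real (card {C \<in> E. A \<subseteq> C}) + 1"
    proof (cases "B \<in> E")
      case True
      \<comment> \<open>An edge already in \<open>E\<close> is itself saturated: its bound is
        \<open>q ^ 0 = 1\<close> and its degree is at least 1.\<close>
      then have "{C \<in> E. B \<subseteq> C} \<noteq> {}" by auto
      then have "card {C \<in> E. B \<subseteq> C} > 0" using fE by (simp add: card_gt_0_iff)
      then show ?thesis
        using assms(2)[OF B] assms(3) by (intro exI[of _ B]) auto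
    next
      case False
      show ?thesis
      proof (rule ccontr)
        assume "\<not> ?thesis"
        then have unsat: "real (card {C \<in> E. A \<subseteq> C}) + 1 \<le> q ^ (k - card A)"
          if "A \<subseteq> B" "A \<noteq> {}" for A using that by (meson not_less)
        have "insert B E \<in> good"
          unfolding good_def
        proof (intro CollectI conjI allI impI)
          show "insert B E \<subseteq> K" using B E by (auto simp: good_def)
          fix A :: "'a set" assume A: "card A \<in> {1..k}"
          show "real (card {C \<in> insert B E. A \<subseteq> C}) \<le> q ^ (k - card A)"
          proof (cases "A \<subseteq> B")
            case True
            then have "{C \<in> insert B E. A \<subseteq> C} = insert B {C \<in> E. A \<subseteq> C}" by auto
            moreover have "A \<noteq> {}" using A by auto
            ultimately show ?thesis using unsat[OF True] \<open>B \<notin> E\<close> fE by simp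
          next
            case False
            then have "{C \<in> insert B E. A \<subseteq> C} = {C \<in> E. A \<subseteq> C}" by auto
            then show ?thesis using E A by (simp add: good_def)
          qed
        qed
        then show False using max[of "insert B E"] False by auto
      qed
    qed
  qed
qed

text \<open>As \<open>q \<ge> 1\<close>, a saturated set has positive degree d, so its bound is
  below d + 1 and hence at most 2 d. Double counting pairs of a set of \<open>T\<close> inside an
  edge then gives at most \<open>2 ^ k\<close> per edge.\<close>

lemma sum_saturated_le:
  fixes q :: real
  assumes "finite E" "\<And>B. B \<in> E \<Longrightarrow> card B = k" "k \<ge> 1" "q \<ge> 1"
    and "finite T" "\<And>A. A \<in> T \<Longrightarrow> q ^ (k - card A) < real (card {B \<in> E. A \<subseteq> B}) + 1"
  shows "(\<Sum>A\<in>T. q ^ (k - card A)) \<le> 2 ^ (k + 1) * real (card E)"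
proof -
  have "(\<Sum>A\<in>T. q ^ (k - card A)) \<le> (\<Sum>A\<in>T. 2 * real (card {B \<in> E. A \<subseteq> B}))"
  proof (rule sum_mono)
    fix A assume A: "A \<in> T"
    have "1 \<le> q ^ (k - card A)" using assms(4) by simp
    then have "real (card {B \<in> E. A \<subseteq> B}) > 0" using assms(6)[OF A] by linarith
    then have "real (card {B \<in> E. A \<subseteq> B}) \<ge> 1" by simp
    then show "q ^ (k - card A) \<le> 2 * real (card {B \<in> E. A \<subseteq> B})"
      using assms(6)[OF A] by linarith
  qed
  also have "\<dots> = 2 * real (\<Sum>A\<in>T. card {B \<in> E. A \<subseteq> B})"
    by (simp add: sum_distrib_left)
  also have "(\<Sum>A\<in>T. card {B \<in> E. A \<subseteq> B}) = (\<Sum>B\<in>E. card {A \<in> T. A \<subseteq> B})"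
    using assms by (intro sum_multicount_gen) auto
  also have "real \<dots> \<le> real (\<Sum>B\<in>E. 2 ^ k)"
  proof (intro of_nat_mono sum_mono)
    fix B assume B: "B \<in> E"
    have fB: "finite B" using assms(2)[OF B] assms(3) by (metis card.infinite not_one_le_zero)
    have "card {A \<in> T. A \<subseteq> B} \<le> card (Pow B)"
      using fB by (intro card_mono) auto
    then show "card {A \<in> T. A \<subseteq> B} \<le> 2 ^ k"
      using fB assms(2)[OF B] by (simp add: card_Pow)
  qed
  finally show ?thesis by (simp add: mult_ac)
qed

text \<open>Delete one point from each member of \<open>T\<close> inside \<open>D\<close>. If k
  points survived, they would contain a member of \<open>T\<close>, whose chosen point was
  deleted.\<close>

lemma card_le_of_hitting:
  assumes "finite D" "k \<ge> 1"
    and "\<And>B. B \<subseteq> D \<Longrightarrow> card B = k \<Longrightarrow> \<exists>A\<in>T. A \<subseteq> B"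
    and "{} \<notin> T"
  shows "card D \<le> k - 1 + card {A \<in> T. A \<subseteq> D}"
proof (rule ccontr)
  assume *: "\<not> ?thesis"
  let ?T = "{A \<in> T. A \<subseteq> D}"
  have fT: "finite ?T" using assms(1) by (auto intro: finite_subset[of _ "Pow D"])
  define f where "f A = (SOME x. x \<in> A)" for A :: "'a set"
  have f: "f A \<in> A" if "A \<in> T" for A
    using that assms(4) unfolding f_def by (metis some_in_eq)
  have "card (f ` ?T) \<le> card ?T" using fT by (rule card_image_le)
  moreover have "card D - card (f ` ?T) \<le> card (D - f ` ?T)"
    using fT by (intro diff_card_le_card_Diff) auto
  ultimately have "k \<le> card (D - f ` ?T)" using * assms(2) by linarith
  then obtain B where B: "B \<subseteq> D - f ` ?T" "card B = k"
    using obtain_subset_with_card_n by blast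
  then obtain A where A: "A \<in> T" "A \<subseteq> B" using assms(3)[of B] by auto
  have "A \<in> ?T" using A B(1) by blast
  then have "f A \<notin> B" using B(1) by blast
  then show False using f[OF A(1)] A(2) by blast
qed

section \<open>Balanced supersaturation\<close>

lemma chain_as_sorted_list:
  assumes "finite B" "\<And>X Y. X \<in> B \<Longrightarrow> Y \<in> B \<Longrightarrow> X \<subseteq> Y \<or> Y \<subseteq> X"
  obtains Fs where "set Fs = B" "sorted_wrt (\<supset>) Fs" "length Fs = card B"
proof -
  have "\<exists>Fs. set Fs = B \<and> sorted_wrt (\<supset>) Fs \<and> length Fs = card B"
    using assms
  proof (induction "card B" arbitrary: B)
    case 0
    then show ?case by auto
  next
    case (Suc c)
    then have "B \<noteq> {}" by auto
    then obtain X where X: "X \<in> B" "\<And>Y. Y \<in> B \<Longrightarrow> X \<subseteq> Y \<Longrightarrow> X = Y"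
      using finite_has_maximal[OF Suc.prems(1)] by metis
    have "\<exists>Fs. set Fs = B - {X} \<and> sorted_wrt (\<supset>) Fs \<and> length Fs = card (B - {X})"
      using Suc.hyps(2) Suc.prems X(1) by (intro Suc.hyps(1)) auto
    then obtain Fs where Fs: "set Fs = B - {X}" "sorted_wrt (\<supset>) Fs" "length Fs = card (B - {X})"
      by blast
    have "X \<supset> Y" if "Y \<in> set Fs" for Y
    proof -
      have "Y \<in> B" "Y \<noteq> X" using that Fs(1) by auto
      then show ?thesis using X Suc.prems(2)[OF X(1), of Y] by blast
    qed
    then show ?case
      using Fs X(1) Suc.hyps(2) by (intro exI[of _ "X # Fs"]) auto
  qed
  then show ?thesis using that by blast
qed

lemma sorted_wrt_psupset_distinct: "sorted_wrt (\<supset>) Fs \<Longrightarrow> distinct Fs"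
  by (induction Fs) auto

text \<open>The averaging argument with denominators cleared: all counts are over a sample space of
  size \<open>fact (card S)\<close> times the middle coefficient. No lower bound on
  \<open>card \<F>\<close> enters yet, and \<open>q\<close> stands for the later
  \<open>\<delta> * m\<close>.\<close>

lemma balanced_chain_family:
  fixes q :: real and S :: "'a set"
  assumes "finite S" "\<F> \<subseteq> Pow S" "k \<ge> 1" "q \<ge> 1"
    and gap: "\<And>F G. F \<in> \<F> \<Longrightarrow> G \<in> \<F> \<Longrightarrow> F \<supset> G \<Longrightarrow> q \<le> real (card F choose card G)"
  obtains E where "E \<subseteq> {set Fs | Fs. set Fs \<subseteq> \<F> \<and> length Fs = k \<and> sorted_wrt (\<supset>) Fs}"
    and "\<And>A. card A \<in> {1..k} \<Longrightarrow> real (card {B \<in> E. A \<subseteq> B}) \<le> q ^ (k - card A)"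
    and "(real (card \<F>) - (real k - 1) * real (card S choose (card S div 2))) * q ^ (k - 1)
           \<le> 2 ^ (k + 1) * real (card E)"
proof -
  define K where "K = {set Fs | Fs. set Fs \<subseteq> \<F> \<and> length Fs = k \<and> sorted_wrt (\<supset>) Fs}"
  define N where "N = card S choose (card S div 2)"
  have fF: "finite \<F>" using finite_subset[OF assms(2)] assms(1) by simp
  have KF: "K \<subseteq> Pow \<F>" by (auto simp: K_def)
  then have fK: "finite K" using fF finite_subset by blast
  have cK: "card B = k" if "B \<in> K" for B
    using that by (auto simp: K_def distinct_card sorted_wrt_psupset_distinct)
  obtain E where E: "E \<subseteq> K"
    and deg: "\<And>A. card A \<in> {1..k} \<Longrightarrow> real (card {B \<in> E. A \<subseteq> B}) \<le> q ^ (k - card A)"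
    and sat: "\<And>B. B \<in> K \<Longrightarrow> \<exists>A\<subseteq>B. A \<noteq> {} \<and> q ^ (k - card A) < real (card {C \<in> E. A \<subseteq> C}) + 1"
    using maximal_bounded_degree_family[OF fK cK assms(3,4)] by blast
  have fE: "finite E" using E fK finite_subset by blast
  \<comment> \<open>The saturated sets, with the slack \<open>+ 1\<close> inherited from
    maximality.\<close>
  define T where "T = {A. A \<subseteq> \<F> \<and> A \<noteq> {} \<and> q ^ (k - card A) < real (card {C \<in> E. A \<subseteq> C}) + 1}"
  have fT: "finite T" using fF by (auto simp: T_def)
  define \<Omega> where "\<Omega> = truncated_flags_through S {}"
  \<comment> \<open>\<open>D \<omega>\<close> is the part of the family kept by the sample
    \<open>\<omega>\<close>.\<close>
  define D where "D \<omega> = {X \<in> \<F>. \<omega> \<in> truncated_flags_through S {X}}" for \<omega>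
  have f\<Omega>: "finite \<Omega>" using assms(1) by (simp add: \<Omega>_def)
  have fD: "finite (D \<omega>)" for \<omega> using fF by (simp add: D_def)
  have T_D: "{\<omega> \<in> \<Omega>. A \<subseteq> D \<omega>} = truncated_flags_through S A" if "A \<subseteq> \<F>" for A
    using that by (auto simp: \<Omega>_def D_def truncated_flags_through_def flags_through_def)
  have D_chain: "X \<subseteq> Y \<or> Y \<subseteq> X" if XY: "X \<in> D \<omega>" "Y \<in> D \<omega>" for X Y \<omega>
  proof -
    obtain xs where xs: "set (take (card X) xs) = X" "set (take (card Y) xs) = Y"
      using XY by (auto simp: D_def truncated_flags_through_def flags_through_def)
    show ?thesis
      using set_take_subset_set_take[of "card X" "card Y" xs]
        set_take_subset_set_take[of "card Y" "card X" xs] xs nat_le_linear by metis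
  qed
  \<comment> \<open>Kept sets are prefixes of one permutation, so any k of them form a k-chain and
    contain a saturated set.\<close>
  have D_le: "card (D \<omega>) \<le> k - 1 + card {A \<in> T. A \<subseteq> D \<omega>}" for \<omega>
  proof (rule card_le_of_hitting[OF fD assms(3)])
    fix B assume B: "B \<subseteq> D \<omega>" "card B = k"
    have "finite B" using B fD finite_subset by blast
    then obtain Fs where "set Fs = B" "sorted_wrt (\<supset>) Fs" "length Fs = k"
      using chain_as_sorted_list[of B] D_chain B by (metis subsetD)
    then have BK: "B \<in> K" using B by (auto simp: K_def D_def)
    then have "B \<subseteq> \<F>" using KF by auto
    then show "\<exists>A\<in>T. A \<subseteq> B" using sat[OF BK] unfolding T_def by blast
  qed (simp add: T_def)
  \<comment> \<open>After scaling by \<open>q ^ (k - 1)\<close>, the chain bound for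
    \<open>A\<close> becomes exactly the weight summed in \<open>sum_saturated_le\<close>.\<close>
  have T_weight: "real (card (truncated_flags_through S A)) * q ^ (k - 1)
      \<le> fact (card S) * q ^ (k - card A)" if A: "A \<in> T" for A
  proof -
    \<comment> \<open>A saturated set lies in some edge, hence is itself a chain of at most k sets;
      filtering the list of that edge puts \<open>A\<close> in decreasing order.\<close>
    have "1 \<le> q ^ (k - card A)" using assms(4) by simp
    then have "card {C \<in> E. A \<subseteq> C} \<noteq> 0" using A by (auto simp: T_def)
    then obtain C where C: "C \<in> E" "A \<subseteq> C"
      by (metis (mono_tags, lifting) card.empty empty_Collect_eq)
    then obtain Fs where Fs: "C = set Fs" "set Fs \<subseteq> \<F>" "length Fs = k" "sorted_wrt (\<supset>) Fs"
      using E by (auto simp: K_def)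
    define Xs where "Xs = filter (\<lambda>X. X \<in> A) Fs"
    have Xs: "set Xs = A" "sorted_wrt (\<supset>) Xs"
      using C Fs by (auto simp: Xs_def sorted_wrt_filter)
    then have l: "length Xs = card A" by (metis distinct_card sorted_wrt_psupset_distinct)
    have ne: "Xs \<noteq> []" using A Xs by (auto simp: T_def)
    have "length Xs \<le> k" using Fs(3) by (simp add: Xs_def flip: Fs(3))
    then have k: "k - 1 = (length Xs - 1) + (k - card A)" using l ne by (cases Xs) auto
    have "real (card (truncated_flags_through S (set Xs))) * q ^ (length Xs - 1) \<le> fact (card S)"
      using assms(1,2,4) ne Xs A
      by (intro card_truncated_flags_through_chain_le gap) (auto simp: T_def)
    then show ?thesis
      unfolding k power_add Xs(1) mult.assoc[symmetric] using assms(4) by (intro mult_right_mono) auto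
  qed
  \<comment> \<open>Double count pairs of a sample and a set it keeps: each \<open>X\<close> is kept
    by exactly \<open>fact (card S)\<close> samples.\<close>
  have "card \<F> * fact (card S) = (\<Sum>X\<in>\<F>. card (truncated_flags_through S {X}))"
    using card_truncated_flags_through_singleton[OF assms(1)] assms(2) by (simp add: subset_iff)
  also have "\<dots> = (\<Sum>X\<in>\<F>. card {\<omega> \<in> \<Omega>. X \<in> D \<omega>})"
    by (intro sum.cong refl arg_cong[of _ _ card]) (use T_D[of "{_}"] in auto)
  also have "\<dots> = (\<Sum>\<omega>\<in>\<Omega>. card {X \<in> \<F>. X \<in> D \<omega>})"
    using fF f\<Omega> by (intro sum_multicount_gen) auto
  also have "\<dots> = (\<Sum>\<omega>\<in>\<Omega>. card (D \<omega>))"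
    by (intro sum.cong refl arg_cong[of _ _ card]) (auto simp: D_def)
  also have "\<dots> \<le> (\<Sum>\<omega>\<in>\<Omega>. k - 1 + card {A \<in> T. A \<subseteq> D \<omega>})"
    by (intro sum_mono D_le)
  also have "\<dots> = (k - 1) * (fact (card S) * N) + (\<Sum>\<omega>\<in>\<Omega>. card {A \<in> T. A \<subseteq> D \<omega>})"
    using card_truncated_flags_through_empty[OF assms(1)]
    by (simp add: sum.distrib \<Omega>_def N_def algebra_simps)
  \<comment> \<open>Second double count, now of samples against the saturated sets they
    keep.\<close>
  also have "(\<Sum>\<omega>\<in>\<Omega>. card {A \<in> T. A \<subseteq> D \<omega>}) = (\<Sum>A\<in>T. card {\<omega> \<in> \<Omega>. A \<subseteq> D \<omega>})"
    using fT f\<Omega> by (intro sum_multicount_gen) auto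
  also have "\<dots> = (\<Sum>A\<in>T. card (truncated_flags_through S A))"
    by (intro sum.cong refl arg_cong[of _ _ card] T_D) (auto simp: T_def)
  finally have "real (card \<F> * fact (card S))
      \<le> real ((k - 1) * (fact (card S) * N) + (\<Sum>A\<in>T. card (truncated_flags_through S A)))"
    using of_nat_le_iff by blast
  then have "(real (card \<F>) - (real k - 1) * real N) * fact (card S)
      \<le> (\<Sum>A\<in>T. real (card (truncated_flags_through S A)))"
    unfolding of_nat_add of_nat_mult of_nat_diff[OF assms(3)] of_nat_sum of_nat_fact of_nat_1
    by (simp add: algebra_simps)
  then have "(real (card \<F>) - (real k - 1) * real N) * fact (card S) * q ^ (k - 1)
      \<le> (\<Sum>A\<in>T. real (card (truncated_flags_through S A))) * q ^ (k - 1)"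
    using assms(4) by (intro mult_right_mono) auto
  also have "\<dots> \<le> (\<Sum>A\<in>T. fact (card S) * q ^ (k - card A))"
    unfolding sum_distrib_right by (intro sum_mono T_weight)
  also have "\<dots> = fact (card S) * (\<Sum>A\<in>T. q ^ (k - card A))"
    by (simp add: sum_distrib_left)
  also have "\<dots> \<le> fact (card S) * (2 ^ (k + 1) * real (card E))"
    using sum_saturated_le[OF fE _ assms(3,4) fT] E cK
    by (intro mult_left_mono) (auto simp: T_def)
  finally have "fact (card S) * ((real (card \<F>) - (real k - 1) * real N) * q ^ (k - 1))
      \<le> fact (card S) * (2 ^ (k + 1) * real (card E))"
    by (simp add: mult_ac)
  then have "(real (card \<F>) - (real k - 1) * real N) * q ^ (k - 1) \<le> 2 ^ (k + 1) * real (card E)"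
    by (rule mult_left_le_imp_le) simp
  then show ?thesis using that[of E] E deg by (simp add: K_def N_def)
qed

theorem theorem1p2:
  fixes k :: nat and \<alpha> :: real
  assumes "k \<ge> 2" and "\<alpha> > 0"
  shows "\<exists>\<delta>::real. \<delta> > 0 \<and>
    (\<forall>(n::nat) (\<F>::nat set set) (m::real).
       \<F> \<subseteq> Pow {1..n} \<longrightarrow>
       real (card \<F>) \<ge> (real k - 1 + \<alpha>) * real (n choose (n div 2)) \<longrightarrow>
       m \<ge> 1 / \<delta> \<longrightarrow>
       (\<forall>F\<in>\<F>. \<forall>G\<in>\<F>. F \<supset> G \<longrightarrow> m \<le> real (card F choose card G)) \<longrightarrow>
       (\<exists>H::nat set hypergraph.
          subhypergraph_on k H (chain_hypergraph k n) \<F> \<and>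
          real (num_edges H) \<ge> \<delta> ^ k * m ^ (k - 1) * real (n choose (n div 2)) \<and>
          (\<forall>l. 1 \<le> l \<and> l \<le> k \<longrightarrow> real (max_degree l H) \<le> (\<delta> * m) ^ (k - l))))"
proof -
  \<comment> \<open>The bound by 1 gives \<open>\<delta> * m \<le> m\<close>, so the hypothesis on
    binomial coefficients passes to \<open>q = \<delta> * m\<close>; the other term absorbs the
    factor \<open>2 ^ (k + 1)\<close> in the edge count.\<close>
  define \<delta> where "\<delta> = min 1 (\<alpha> / 2 ^ (k + 1))"
  have \<delta>: "\<delta> > 0" "\<delta> \<le> 1" "2 ^ (k + 1) * \<delta> \<le> \<alpha>"
    using assms(2) by (auto simp: \<delta>_def min_def field_simps)
  show ?thesis
  proof (intro exI[of _ \<delta>] conjI allI impI \<delta>(1))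
    fix n :: nat and \<F> :: "nat set set" and m :: real
    let ?N = "n choose (n div 2)"
    assume F: "\<F> \<subseteq> Pow {1..n}" and large: "real (card \<F>) \<ge> (real k - 1 + \<alpha>) * real ?N"
      and m: "m \<ge> 1 / \<delta>" and gap: "\<forall>F\<in>\<F>. \<forall>G\<in>\<F>. F \<supset> G \<longrightarrow> m \<le> real (card F choose card G)"
    have fF: "finite \<F>" using F finite_subset by blast
    have q: "\<delta> * m \<ge> 1" using m \<delta>(1) by (simp add: field_simps)
    have "m > 0" using m \<delta>(1) by (meson less_le_trans zero_less_divide_1_iff)
    then have qm: "\<delta> * m \<le> m" using \<delta> by (simp add: mult_left_le_one_le)
    obtain E where E: "E \<subseteq> {set Fs | Fs. set Fs \<subseteq> \<F> \<and> length Fs = k \<and> sorted_wrt (\<supset>) Fs}"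
      and deg: "\<And>A. card A \<in> {1..k} \<Longrightarrow> real (card {B \<in> E. A \<subseteq> B}) \<le> (\<delta> * m) ^ (k - card A)"
      and num: "(real (card \<F>) - (real k - 1) * real ?N) * (\<delta> * m) ^ (k - 1)
           \<le> 2 ^ (k + 1) * real (card E)"
      using balanced_chain_family[of "{1..n}" \<F> k "\<delta> * m"] F assms(1) q qm gap
      by (smt (verit) card_atLeastAtMost diff_Suc_1 finite_atLeastAtMost one_le_numeral order.trans)
    define H where "H = \<lparr>verts = \<F>, edges = E\<rparr>"
    have "?N > 0" by (simp add: zero_less_binomial)
    \<comment> \<open>The family needs at least k members so that \<open>max_degree l H\<close> is a
      maximum over a nonempty set for every \<open>l \<le> k\<close>.\<close>
    have "real k - 1 < real (card \<F>)"
    proof -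
      have "real k - 1 < (real k - 1 + \<alpha>) * 1" using assms(2) by simp
      also have "\<dots> \<le> (real k - 1 + \<alpha>) * real ?N"
        using assms \<open>?N > 0\<close> by (intro mult_left_mono) (auto simp: Suc_le_eq)
      finally show ?thesis using large by linarith
    qed
    then have kF: "k \<le> card \<F>" by linarith
    have "subhypergraph_on k H (chain_hypergraph k n) \<F>"
      using E F sorted_wrt_psupset_distinct distinct_card
      unfolding subhypergraph_on_def uniform_hypergraph_def chain_hypergraph_def H_def
      by fastforce
    moreover have "real (num_edges H) \<ge> \<delta> ^ k * m ^ (k - 1) * real ?N"
    proof -
      \<comment> \<open>The excess of \<open>card \<F>\<close> over \<open>(k - 1) * ?N\<close> is
        at least \<open>\<alpha> * ?N\<close>. After cancelling \<open>2 ^ (k + 1)\<close>, the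
        leftover \<open>\<delta>\<close> joins \<open>\<delta> ^ (k - 1)\<close> to give
        \<open>\<delta> ^ k\<close>.\<close>
      have "2 ^ (k + 1) * \<delta> * real ?N * (\<delta> * m) ^ (k - 1) \<le> \<alpha> * real ?N * (\<delta> * m) ^ (k - 1)"
        using \<delta> q by (intro mult_right_mono) auto
      also have "\<dots> \<le> (real (card \<F>) - (real k - 1) * real ?N) * (\<delta> * m) ^ (k - 1)"
        using large q by (intro mult_right_mono zero_le_power) (auto simp: algebra_simps)
      also note num
      finally have "\<delta> * real ?N * (\<delta> * m) ^ (k - 1) \<le> real (card E)"
        by (simp add: mult.assoc)
      moreover have "\<delta> ^ k = \<delta> * \<delta> ^ (k - 1)" using assms(1) by (simp flip: power_Suc)
      ultimately show ?thesis by (simp add: num_edges_def H_def power_mult_distrib mult_ac)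
    qed
    moreover have "real (max_degree l H) \<le> (\<delta> * m) ^ (k - l)" if l: "1 \<le> l \<and> l \<le> k" for l
    proof -
      let ?M = "{hdegree H A | A. A \<subseteq> verts H \<and> finite A \<and> card A = l}"
      have "finite ?M"
        using fF by (auto simp: H_def)
      moreover obtain A where "A \<subseteq> \<F>" "card A = l" "finite A"
        using obtain_subset_with_card_n[of l \<F>] kF l by auto
      then have "?M \<noteq> {}" by (auto simp: H_def)
      \<comment> \<open>The maximum is attained, so the degree bound for one set of size
        \<open>l\<close> suffices.\<close>
      ultimately have "max_degree l H \<in> ?M"
        unfolding max_degree_def by (rule Max_in)
      then obtain A where "card A = l" "max_degree l H = card {B \<in> E. A \<subseteq> B}"
        by (auto simp: hdegree_def H_def)
      then show ?thesis using deg[of A] l by auto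
    qed
    ultimately show "\<exists>H::nat set hypergraph.
          subhypergraph_on k H (chain_hypergraph k n) \<F> \<and>
          real (num_edges H) \<ge> \<delta> ^ k * m ^ (k - 1) * real ?N \<and>
          (\<forall>l. 1 \<le> l \<and> l \<le> k \<longrightarrow> real (max_degree l H) \<le> (\<delta> * m) ^ (k - l))"
      by blast
  qed
qed

end
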